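(* Let $n,t\in\mathbb N$, let $G\subseteq\operatorname{Sym}\mathbb R[\bar X]^{t\times t}$ be a (possibly infinite) set of symmetric matrix polynomials, and suppose that the quadratic module $M_G$ is archimedean. Then associating to each $(x,[v])\in S_G\times\mathbb P^{t-1}(\mathbb R)$, where $v$ is a unit vector of $\mathbb R^t$, the map $$\operatorname{Sym}\mathbb R[\bar X]^{t\times t}\to\mathbb R,\qquad p\mapsto\langle p(x)v,v\rangle$$ gives a well-defined bijection from $S_G\times\mathbb P^{t-1}(\mathbb R)$ onto the set of pure states on $(\operatorname{Sym}\mathbb R[\bar X]^{t\times t},M_G)$.
   Context: $\mathbb N=\{1,2,\dots\}$. $\mathbb R[\bar X]$ is the (commutative) polynomial ring in $n$ variables $\bar X=(X_1,\dots,X_n)$. $\mathbb R[\bar X]^{t\times t}$ is the ring of $t\times t$ matrices over $\mathbb R[\bar X]$ with involution $*$ the transpose, and $\operatorname{Sym}\mathbb R[\bar X]^{t\times t}=\{p\in\mathbb R[\bar X]^{t\times t}\mid p=p^*\}$. $1$ denotes the identity matrix, and scalars are identified with scalar multiples of it. $\langle\cdot,\cdot\rangle$ is the standard inner product on $\mathbb R^t$. For a symmetric real matrix $A$, $A\succeq0$ means $A$ is positive semidefinite. For $0\neq v\in\mathbb R^t$, $[v]$ denotes the line spanned by $v$, viewed as an element of the real projective space $\mathbb P^{t-1}(\mathbb R)$ of dimension $t-1$. For $G\subseteq\operatorname{Sym}\mathbb R[\bar X]^{t\times t}$: $S_G=\{x\in\mathbb R^n\mid g(x)\succeq0\text{ for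 all }g\in G\}$, and $M_G=\{\sum_{i=1}^Np_i^*g_ip_i\mid N\in\mathbb N,\ g_i\in\{1\}\cup G,\ p_i\in\mathbb R[\bar X]^{t\times t}\}$ (the quadratic module generated by $G$). $M_G$ is archimedean if for every $a\in\mathbb R[\bar X]^{t\times t}$ there is $N\in\mathbb N$ with $N-a^*a\in M_G$. A state on $(\operatorname{Sym}\mathbb R[\bar X]^{t\times t},M_G)$ is an $\mathbb R$-linear form $L:\operatorname{Sym}\mathbb R[\bar X]^{t\times t}\to\mathbb R$ with $L(M_G)\subseteq\mathbb R_{\ge0}$ and $L(1)=1$. A state is pure if it is an extreme point of the convex set of all states, i.e. it is not a proper convex combination of two states other than itself. *)

theory Defs
  imports "HOL-Analysis.Analysis" "HOL-Library.Poly_Mapping"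
begin

(* A monomial is a finitely supported map from variables to exponents, so this is the
   monoid algebra of the free commutative monoid on 'n, i.e. the polynomial ring over
   the reals in CARD('n) commuting variables. *)
type_synonym 'n rpoly = "('n \<Rightarrow>\<^sub>0 nat) \<Rightarrow>\<^sub>0 real"

type_synonym ('n, 't) matpoly = "'n rpoly ^ 't ^ 't"

definition poly_eval :: "'n::finite rpoly \<Rightarrow> real ^ 'n \<Rightarrow> real" where
  "poly_eval p x =
     (\<Sum>m\<in>Poly_Mapping.keys p. Poly_Mapping.lookup p m * (\<Prod>i\<in>UNIV. x $ i ^ Poly_Mapping.lookup m i))"

definition mat_eval :: "('n::finite, 't::finite) matpoly \<Rightarrow> real ^ 'n \<Rightarrow> real ^ 't ^ 't" where
  "mat_eval p x = (\<chi> i j. poly_eval (p $ i $ j) x)"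

(* real scalars as constant multiples of the identity matrix *)
definition scalar :: "real \<Rightarrow> ('n::finite, 't::finite) matpoly" where
  "scalar c = mat (Poly_Mapping.single 0 c)"

definition Sym :: "('n::finite, 't::finite) matpoly set" where
  "Sym = {p. transpose p = p}"

definition psd :: "real ^ 't ^ 't::finite \<Rightarrow> bool" where
  "psd A \<longleftrightarrow> transpose A = A \<and> (\<forall>v. 0 \<le> (A *v v) \<bullet> v)"

definition pos_set :: "('n::finite, 't::finite) matpoly set \<Rightarrow> (real ^ 'n) set" where
  "pos_set G = {x. \<forall>g\<in>G. psd (mat_eval g x)}"

definition quad_module :: "('n::finite, 't::finite) matpoly set \<Rightarrow> ('n, 't) matpoly set" where
  "quad_module G =
     {(\<Sum>i=1..N. transpose (p i) ** g i ** p i) | (N::nat) p g.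
        1 \<le> N \<and> (\<forall>i\<in>{1..N}. g i \<in> insert (mat 1) G)}"

definition archimedean :: "('n::finite, 't::finite) matpoly set \<Rightarrow> bool" where
  "archimedean M \<longleftrightarrow>
     (\<forall>a :: ('n, 't) matpoly. \<exists>N::nat. 1 \<le> N \<and> scalar (real N) - transpose a ** a \<in> M)"

(* A linear form on Sym is encoded as a function on all matrix polynomials that has the
   value undefined outside Sym, so that equality of states is equality on Sym. *)
definition states :: "('n::finite, 't::finite) matpoly set \<Rightarrow> (('n, 't) matpoly \<Rightarrow> real) set" where
  "states M =
     {L \<in> extensional Sym.
        (\<forall>p\<in>Sym. \<forall>q\<in>Sym. L (p + q) = L p + L q) \<and>
        (\<forall>c. \<forall>p\<in>Sym. L (scalar c ** p) = c * L p) \<and>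
        (\<forall>p\<in>M. 0 \<le> L p) \<and>
        L (mat 1) = 1}"

definition pure_states :: "('n::finite, 't::finite) matpoly set \<Rightarrow> (('n, 't) matpoly \<Rightarrow> real) set" where
  "pure_states M =
     {L \<in> states M.
        \<forall>L1\<in>states M. \<forall>L2\<in>states M. \<forall>s::real.
          0 < s \<and> s < 1 \<and> (\<forall>p\<in>Sym. L p = s * L1 p + (1 - s) * L2 p) \<longrightarrow> L1 = L \<and> L2 = L}"

abbreviation line :: "real ^ 't \<Rightarrow> (real ^ 't::finite) set" where
  "line v \<equiv> span {v}"

definition proj_space :: "(real ^ 't::finite) set set" where
  "proj_space = {line v | v. v \<noteq> 0}"

definition vec_state :: "real ^ 'n::finite \<Rightarrow> real ^ 't::finite \<Rightarrow> ('n, 't) matpoly \<Rightarrow> real" where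
  "vec_state x v = (\<lambda>p\<in>Sym. (mat_eval p x *v v) \<bullet> v)"

(* l is meant to be a point of proj_space; the value is significant only if vec_state x v
   does not depend on the choice of the unit vector v spanning l. *)
definition line_state :: "real ^ 'n::finite \<Rightarrow> (real ^ 't::finite) set \<Rightarrow> ('n, 't) matpoly \<Rightarrow> real" where
  "line_state x l = (THE L. \<exists>v. norm v = 1 \<and> line v = l \<and> L = vec_state x v)"

end

theory Submission
  imports Defs
begin

text \<open>
  Let \<open>L\<close> be a pure state and \<open>f\<close> a scalar polynomial. By the Cauchy-Schwarz inequality, applied to
  the powers of \<open>f\<^sup>2\<close>, the archimedean bound \<open>N - f\<^sup>2 \<in> M\<close> gives \<open>L(f\<^sup>2 p) \<le> N L(p)\<close> for all
  \<open>p \<in> M\<close>, so that purity forces \<open>L(f\<^sup>2 p) = L(f\<^sup>2) L(p)\<close>. By polarization \<open>L(f p) = L(f) L(p)\<close>.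
  Hence \<open>L(p) = tr(p(x) B)\<close> with \<open>x\<^sub>i = L(X\<^sub>i)\<close> and a density matrix \<open>B\<close>. Splitting off a rank one
  part of \<open>B\<close> and using purity again gives \<open>B = v v\<^sup>T\<close>. Conversely, a state \<open>K\<close> that is dominated on
  \<open>M\<close> by a multiple of the state of \<open>(x, v)\<close> vanishes on \<open>(X\<^sub>i - x\<^sub>i)\<^sup>2\<close> and on \<open>u u\<^sup>T\<close> for all
  \<open>u\<close> orthogonal to \<open>v\<close>, so that it is given by \<open>x\<close> and \<open>B = v v\<^sup>T\<close> as well. The trace pairing
  \<open>tr(C B)\<close> of symmetric matrices is the inner product \<open>C \<bullet> B\<close>.
\<close>

section \<open>Evaluation of polynomials and matrix polynomials\<close>

lemma poly_induct [case_names single add]: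
  fixes p :: "'a \<Rightarrow>\<^sub>0 'b::monoid_add"
  assumes single: "\<And>m c. P (Poly_Mapping.single m c)"
    and add: "\<And>p q. P p \<Longrightarrow> P q \<Longrightarrow> P (p + q)"
  shows "P p"
proof (induction p rule: update_induct)
  case const
  \<comment> \<open>Zero is a single term with coefficient 0; its key is arbitrary.\<close>
  show ?case using single[of undefined 0] by simp
next
  case (update f a b)
  \<comment> \<open>The key \<open>a\<close> does not occur in \<open>f\<close>, so the update only
    replaces a zero coefficient.\<close>
  have "Poly_Mapping.update a b f = f + Poly_Mapping.single a b"
    using update(1) by (intro poly_mapping_eqI)
      (auto simp: lookup_update lookup_add lookup_single when_def in_keys_iff)
  then show ?case using add[OF update(3) single] by simp
qed

definition mon_eval :: "('n::finite \<Rightarrow>\<^sub>0 nat) \<Rightarrow> real ^ 'n \<Rightarrow> real" where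
  "mon_eval m x = (\<Prod>i\<in>UNIV. x $ i ^ Poly_Mapping.lookup m i)"

lemma mon_eval_0 [simp]: "mon_eval 0 x = 1"
  by (simp add: mon_eval_def)

lemma mon_eval_add: "mon_eval (m + k) x = mon_eval m x * mon_eval k x"
  by (simp add: mon_eval_def lookup_add power_add prod.distrib)

lemma poly_eval_superset:
  assumes "finite A" "Poly_Mapping.keys p \<subseteq> A"
  shows "poly_eval p x = (\<Sum>m\<in>A. Poly_Mapping.lookup p m * mon_eval m x)"
  unfolding poly_eval_def mon_eval_def using assms
  by (intro sum.mono_neutral_left) (auto simp: in_keys_iff)

lemma poly_eval_single [simp]: "poly_eval (Poly_Mapping.single m c) x = c * mon_eval m x"
  by (subst poly_eval_superset[of "{m}"]) auto

lemma poly_eval_0 [simp]: "poly_eval 0 x = 0"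
  by (simp add: poly_eval_def)

lemma poly_eval_1 [simp]: "poly_eval 1 x = 1"
  using poly_eval_single[of 0 1 x] by simp

lemma poly_eval_add [simp]: "poly_eval (p + q) x = poly_eval p x + poly_eval q x"
proof -
  let ?A = "Poly_Mapping.keys p \<union> Poly_Mapping.keys q"
  have "poly_eval r x = (\<Sum>m\<in>?A. Poly_Mapping.lookup r m * mon_eval m x)"
    if "r \<in> {p, q, p + q}" for r
    using that keys_add[of p q] by (intro poly_eval_superset) auto
  then show ?thesis by (simp add: lookup_add distrib_right sum.distrib)
qed

lemma poly_eval_mult [simp]: "poly_eval (p * q) x = poly_eval p x * poly_eval q x"
proof (induction p rule: poly_induct)
  case (single m c)
  show ?case
    by (induction q rule: poly_induct) (simp_all add: mult_single mon_eval_add algebra_simps)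
qed (simp add: algebra_simps)

lemma poly_eval_uminus [simp]: "poly_eval (- p) x = - poly_eval p x"
  using poly_eval_add[of p "- p" x] by simp

lemma poly_eval_diff [simp]: "poly_eval (p - q) x = poly_eval p x - poly_eval q x"
  using poly_eval_add[of p "- q" x] by simp

lemma poly_eval_sum [simp]: "poly_eval (\<Sum>i\<in>A. f i) x = (\<Sum>i\<in>A. poly_eval (f i) x)"
  by (induction A rule: infinite_finite_induct) auto

section \<open>Variables as generators of the polynomial ring\<close>

definition Var :: "'n \<Rightarrow> 'n rpoly" where
  "Var i = Poly_Mapping.single (Poly_Mapping.single i 1) 1"

lemma poly_eval_Var [simp]: "poly_eval (Var i) x = x $ i"
proof -
  have "x $ j ^ (1 when i = j) = (if j = i then x $ i else 1)" for j
    by (auto simp: when_def)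
  then show ?thesis
    by (simp add: Var_def mon_eval_def lookup_single prod.delta)
qed

lemma monomial_induct [case_names zero Suc]:
  fixes m :: "'n \<Rightarrow>\<^sub>0 nat"
  assumes zero: "P 0" and Suc: "\<And>m i. P m \<Longrightarrow> P (Poly_Mapping.single i 1 + m)"
  shows "P m"
proof -
  have step: "P (Poly_Mapping.single i c + k)" if "P k" for i c and k :: "'n \<Rightarrow>\<^sub>0 nat"
  proof (induction c)
    case (Suc c)
    have "Poly_Mapping.single i (Suc c) + k
          = Poly_Mapping.single i 1 + (Poly_Mapping.single i c + k)"
      by (simp flip: single_add add.assoc)
    then show ?case using assms(2)[OF Suc] by simp
  qed (simp add: that)
  \<comment> \<open>The property that adding \<open>m\<close> preserves \<open>P\<close> is
    inherited by sums of such \<open>m\<close>, whereas \<open>P\<close> itself need not be closed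
    under sums. The claim is the case \<open>k = 0\<close>.\<close>
  have "\<forall>k. P k \<longrightarrow> P (m + k)"
    by (induction m rule: poly_induct) (auto simp: step add.assoc)
  then show ?thesis using zero by (metis add.right_neutral)
qed

text \<open>Constants and variables generate the ring. This reduces the values of a state on scalar
  multiples to its behaviour under multiplication by variables.\<close>

lemma poly_ring_induct [case_names const Var add mult]:
  fixes p :: "'n rpoly"
  assumes const: "\<And>c. P (Poly_Mapping.single 0 c)" and Var: "\<And>i. P (Var i)"
    and add: "\<And>p q. P p \<Longrightarrow> P q \<Longrightarrow> P (p + q)"
    and mult: "\<And>p q. P p \<Longrightarrow> P q \<Longrightarrow> P (p * q)"
  shows "P p"
proof (induction p rule: poly_induct)
  case (single m c)
  show ?case
  proof (induction m rule: monomial_induct)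
    case (Suc m i)
    have "Poly_Mapping.single (Poly_Mapping.single i 1 + m) c = Var i * Poly_Mapping.single m c"
      by (simp add: Var_def mult_single)
    then show ?case using mult[OF Var Suc] by simp
  qed (rule const)
qed (rule add)

section \<open>Constant matrices, scalar multiples and symmetric matrix polynomials\<close>

definition outer :: "'a::times ^ 't \<Rightarrow> 'a ^ 't \<Rightarrow> 'a ^ 't ^ 't" where
  "outer v w = (\<chi> i j. v $ i * w $ j)"

definition cmat :: "real ^ 't ^ 't \<Rightarrow> ('n::finite, 't::finite) matpoly" where
  "cmat C = (\<chi> i j. Poly_Mapping.single 0 (C $ i $ j))"

text \<open>Multiplication by a scalar polynomial is expressed throughout as the product with the
  diagonal matrix \<open>mat f\<close>, so that identities for it reduce to entrywise ones.\<close>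

lemma mat_mult_nth: "(mat f ** p) $ i $ j = f * p $ i $ j"
  for f :: "'a::semiring_1" and p :: "'a ^ 'n ^ 'm::finite"
  by (simp add: matrix_matrix_mult_def mat_def if_distrib[of "\<lambda>x. x * _"] sum.delta cong: if_cong)

lemma mult_mat_nth: "(p ** mat f) $ i $ j = p $ i $ j * f"
  for f :: "'a::semiring_1" and p :: "'a ^ 'n::finite ^ 'm"
  by (simp add: matrix_matrix_mult_def mat_def if_distrib[of "\<lambda>x. _ * x"] sum.delta cong: if_cong)

lemma mat_commute: "p ** mat f = mat f ** p"
  for f :: "'a::comm_semiring_1" and p :: "'a ^ 'n::finite ^ 'n"
  by (simp add: vec_eq_iff mat_mult_nth mult_mat_nth mult.commute)

lemma mat_mult_mat: "mat f ** (mat g ** p) = mat (f * g) ** p"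
  for f :: "'a::semiring_1" and p :: "'a ^ 'n ^ 'm::finite"
  by (simp add: vec_eq_iff mat_mult_nth mult.assoc)

lemma mat_eval_add [simp]: "mat_eval (p + q) x = mat_eval p x + mat_eval q x"
  by (simp add: mat_eval_def vec_eq_iff)

lemma mat_eval_mult [simp]: "mat_eval (p ** q) x = mat_eval p x ** mat_eval q x"
  by (simp add: mat_eval_def vec_eq_iff matrix_matrix_mult_def)

lemma mat_eval_transpose [simp]: "mat_eval (transpose p) x = transpose (mat_eval p x)"
  by (simp add: mat_eval_def vec_eq_iff transpose_def)

lemma mat_eval_mat [simp]: "mat_eval (mat f) x = mat (poly_eval f x)"
  by (simp add: mat_eval_def vec_eq_iff mat_def)

lemma mat_eval_cmat [simp]: "mat_eval (cmat C) x = C"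
  by (simp add: mat_eval_def vec_eq_iff cmat_def)

lemma cmat_transpose: "cmat (transpose C) = transpose (cmat C)"
  by (simp add: cmat_def vec_eq_iff transpose_def)

lemma matrix_add_distrib_right: "(A + B) ** C = A ** C + B ** C"
  for A B :: "'a::semiring_1 ^ 'n::finite ^ 'm"
  by (simp add: matrix_matrix_mult_def vec_eq_iff distrib_right sum.distrib)

lemma Sym_mat [simp]: "mat f \<in> Sym"
  by (simp add: Sym_def)

lemma transpose_add: "transpose (A + B) = transpose A + transpose B"
  by (simp add: transpose_def vec_eq_iff)

lemma Sym_iff: "p \<in> Sym \<longleftrightarrow> (\<forall>i j. p $ i $ j = p $ j $ i)"
  by (auto simp: Sym_def vec_eq_iff transpose_def)

lemma Sym_0 [simp]: "0 \<in> Sym"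
  by (simp add: Sym_iff)

lemma Sym_add [intro]: "p \<in> Sym \<Longrightarrow> q \<in> Sym \<Longrightarrow> p + q \<in> Sym"
  by (simp add: Sym_iff)

lemma Sym_diff [intro]: "p \<in> Sym \<Longrightarrow> q \<in> Sym \<Longrightarrow> p - q \<in> Sym"
  by (simp add: Sym_iff)

lemma Sym_sum [intro]: "(\<And>i. i \<in> A \<Longrightarrow> f i \<in> Sym) \<Longrightarrow> sum f A \<in> Sym"
  by (induction A rule: infinite_finite_induct) auto

lemma Sym_mat_mult [intro]: "p \<in> Sym \<Longrightarrow> mat f ** p \<in> Sym"
  by (simp add: Sym_iff mat_mult_nth)

lemma Sym_congruence: "g \<in> Sym \<Longrightarrow> transpose p ** g ** p \<in> Sym"
  by (simp add: Sym_def matrix_transpose_mul matrix_mul_assoc)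

lemma cmat_Sym: "transpose C = C \<Longrightarrow> cmat C \<in> Sym"
  by (simp add: Sym_def flip: cmat_transpose)

section \<open>Quadratic modules\<close>

lemma qm_generator:
  assumes "g \<in> insert (mat 1) G"
  shows "transpose p ** g ** p \<in> quad_module G"
proof -
  have "transpose p ** g ** p = (\<Sum>i=1..(1::nat). transpose p ** g ** p)" by simp
  then show ?thesis using assms unfolding quad_module_def mem_Collect_eq
    by (intro exI[of _ 1] exI[of _ "\<lambda>_. p"] exI[of _ "\<lambda>_. g"]) simp
qed

lemma qm_add:
  fixes G :: "('n::finite, 't::finite) matpoly set"
  assumes "a \<in> quad_module G" "b \<in> quad_module G"
  shows "a + b \<in> quad_module G"
proof -
  obtain N and p g :: "nat \<Rightarrow> ('n, 't) matpoly" where a: "a = (\<Sum>i=1..N. transpose (p i) ** g i ** p i)" "1 \<le> N"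
    "\<forall>i\<in>{1..N}. g i \<in> insert (mat 1) G"
    using assms(1) unfolding quad_module_def by blast
  obtain N' and p' g' :: "nat \<Rightarrow> ('n, 't) matpoly" where b: "b = (\<Sum>i=1..N'. transpose (p' i) ** g' i ** p' i)"
    "\<forall>i\<in>{1..N'}. g' i \<in> insert (mat 1) G"
    using assms(2) unfolding quad_module_def by blast
  \<comment> \<open>Concatenation of the two families: indices above \<open>N\<close> are shifted
    back by \<open>N\<close> into the second one.\<close>
  let ?p = "\<lambda>i. if i \<le> N then p i else p' (i - N)"
  let ?g = "\<lambda>i. if i \<le> N then g i else g' (i - N)"
  have "(\<Sum>i=1..N + N'. transpose (?p i) ** ?g i ** ?p i)
      = (\<Sum>i=1..N. transpose (?p i) ** ?g i ** ?p i)
        + (\<Sum>i=1 + N..N' + N. transpose (?p i) ** ?g i ** ?p i)"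
    by (subst sum.ub_add_nat) (simp_all add: add.commute)
  also have "(\<Sum>i=1 + N..N' + N. transpose (?p i) ** ?g i ** ?p i) = b"
    unfolding b(1) by (subst sum.shift_bounds_cl_nat_ivl) simp
  also have "(\<Sum>i=1..N. transpose (?p i) ** ?g i ** ?p i) = a"
    unfolding a(1) by (intro sum.cong) auto
  finally have "a + b = (\<Sum>i=1..N + N'. transpose (?p i) ** ?g i ** ?p i)" ..
  moreover have "\<forall>i\<in>{1..N + N'}. ?g i \<in> insert (mat 1) G"
  proof
    fix i assume "i \<in> {1..N + N'}"
    then have "i \<in> {1..N} \<or> i - N \<in> {1..N'} \<and> \<not> i \<le> N" by auto
    then show "?g i \<in> insert (mat 1) G" using a(3) b(2) by (auto simp del: insert_iff)
  qed
  moreover have "1 \<le> N + N'" using a(2) by simp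
  ultimately show ?thesis unfolding quad_module_def mem_Collect_eq
    by (intro exI[of _ "N + N'"] exI[of _ ?p] exI[of _ ?g] conjI)
qed

lemma qm_induct [consumes 1, case_names generator add]:
  fixes G :: "('n::finite, 't::finite) matpoly set"
  assumes "m \<in> quad_module G"
    and gen: "\<And>g p. g \<in> insert (mat 1) G \<Longrightarrow> P (transpose p ** g ** p)"
    and add: "\<And>a b. P a \<Longrightarrow> P b \<Longrightarrow> P (a + b)"
  shows "P m"
proof -
  obtain N and p g :: "nat \<Rightarrow> ('n, 't) matpoly" where m: "m = (\<Sum>i=1..N. transpose (p i) ** g i ** p i)" "1 \<le> N"
    "\<forall>i\<in>{1..N}. g i \<in> insert (mat 1) G"
    using assms(1) unfolding quad_module_def by blast
  \<comment> \<open>Only nonempty index sets occur, because \<open>P 0\<close> is not given;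
    \<open>1 \<le> N\<close> makes \<open>{1..N}\<close> one of them.\<close>
  have "P (\<Sum>i\<in>I. transpose (p i) ** g i ** p i)" if "finite I" "I \<noteq> {}" "I \<subseteq> {1..N}" for I
    using that
  proof (induction I rule: finite_ne_induct)
    case (singleton i)
    then show ?case using gen[of "g i" "p i"] m(3) by auto
  next
    case (insert i I)
    have "P (transpose (p i) ** g i ** p i)" using gen[of "g i" "p i"] m(3) insert by blast
    then show ?case using insert by (simp add: add)
  qed
  from this[of "{1..N}"] show ?thesis using m(1,2) by simp
qed

lemma qm_congruence:
  assumes "m \<in> quad_module G"
  shows "transpose q ** m ** q \<in> quad_module G"
  using assms
proof (induction rule: qm_induct)
  case (generator g p)
  have "transpose q ** (transpose p ** g ** p) ** q = transpose (p ** q) ** g ** (p ** q)"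
    by (simp add: matrix_transpose_mul matrix_mul_assoc)
  then show ?case using qm_generator[OF generator] by simp
next
  case (add a b)
  have "transpose q ** (a + b) ** q = transpose q ** a ** q + transpose q ** b ** q"
    by (simp add: matrix_add_ldistrib matrix_add_distrib_right)
  then show ?case using qm_add[OF add] by simp
qed

lemma qm_subset_Sym: "G \<subseteq> Sym \<Longrightarrow> quad_module G \<subseteq> Sym"
proof
  fix m assume "G \<subseteq> Sym" "m \<in> quad_module G"
  show "m \<in> Sym" using \<open>m \<in> quad_module G\<close>
  proof (induction rule: qm_induct)
    case (generator g p)
    with \<open>G \<subseteq> Sym\<close> show ?case by (intro Sym_congruence) auto
  qed auto
qed

lemma qm_square:
  fixes a :: "('n::finite, 't::finite) matpoly"
  shows "transpose a ** a \<in> quad_module G"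
  using qm_generator[of "mat 1" G a] by simp

text \<open>Congruence by the diagonal matrix \<open>mat f\<close> is multiplication by
  \<open>f * f\<close>, since \<open>mat f\<close> commutes with every matrix.\<close>

lemma qm_square_mult: "m \<in> quad_module G \<Longrightarrow> mat (f * f) ** m \<in> quad_module G"
  using qm_congruence[of m G "mat f"] by (simp add: mat_commute mat_mult_mat)

lemma qm_const_mult:
  assumes "m \<in> quad_module G" "0 \<le> c"
  shows "mat (Poly_Mapping.single 0 c) ** m \<in> quad_module G"
  using qm_square_mult[OF assms(1), of "Poly_Mapping.single 0 (sqrt c)"] assms(2)
  by (simp add: mult_single)

section \<open>Positive semidefinite matrices\<close>

text \<open>For \<open>c = 0\<close> a nonconstant affine function would take negative values;
  otherwise the expression is evaluated at its minimum \<open>- b / c\<close>. Both Cauchy-Schwarz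
  inequalities, for matrices and for states, rest on this.\<close>

lemma quadratic_nonneg_imp_discrim:
  fixes a b c :: real
  assumes "\<And>r. 0 \<le> a + 2 * b * r + c * r\<^sup>2" "0 \<le> c"
  shows "b\<^sup>2 \<le> a * c"
proof (cases "c = 0")
  case True
  have "b = 0"
  proof (rule ccontr)
    assume "b \<noteq> 0"
    \<comment> \<open>At this \<open>r\<close> the affine expression equals -1.\<close>
    then show False using assms(1)[of "- (a + 1) / (2 * b)"] True by (simp add: field_simps)
  qed
  then show ?thesis using True by simp
next
  case False
  then have "0 \<le> a - b\<^sup>2 / c"
    using assms(1)[of "- b / c"] by (simp add: field_simps power2_eq_square)
  with False assms(2) show ?thesis by (simp add: field_simps)
qed

section \<open>Rank one matrices and the inner product of matrices\<close>

lemma inner_outer: "C \<bullet> outer v v = (C *v v) \<bullet> v" for C :: "real ^ 't ^ 't::finite"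
  by (simp add: inner_vec_def matrix_vector_mult_def outer_def sum_distrib_left sum_distrib_right
      algebra_simps)

lemma outer_mult_vec: "outer v v *v u = (v \<bullet> u) *\<^sub>R v" for v :: "real ^ 't::finite"
  by (simp add: inner_vec_def matrix_vector_mult_def outer_def vec_eq_iff sum_distrib_left
      algebra_simps)

lemma transpose_outer: "transpose (outer v w) = outer w v" for v w :: "real ^ 't::finite"
  by (simp add: outer_def transpose_def vec_eq_iff mult.commute)

lemma inner_mat_1_outer: "mat 1 \<bullet> outer v v = v \<bullet> v" for v :: "real ^ 't::finite"
  by (simp add: inner_outer)

lemma inner_mat_1: "mat 1 \<bullet> A = (\<Sum>i\<in>UNIV. A $ i $ i)" for A :: "real ^ 't ^ 't::finite"
  by (simp add: inner_vec_def mat_def if_distrib[of "\<lambda>x. x * _"] cong: if_cong)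

lemma inner_mat: "mat c \<bullet> A = c * (mat 1 \<bullet> A)" for A :: "real ^ 't ^ 't::finite"
  by (simp add: inner_vec_def mat_def sum_distrib_left if_distrib[of "\<lambda>x. x * _"] cong: if_cong)

lemma matrix_vector_axis_inner: "(A *v axis j 1) \<bullet> axis i 1 = A $ i $ j"
  for A :: "real ^ 't ^ 't::finite"
  by (simp add: matrix_vector_mult_basis column_def inner_axis)

lemma transpose_inner: "(transpose A *v v) \<bullet> w = v \<bullet> (A *v w)"
  for A :: "real ^ 't::finite ^ 's::finite"
  by (simp add: dot_lmul_matrix)

lemma psd_outer: "psd (outer v v)"
  by (simp add: psd_def transpose_outer outer_mult_vec inner_commute)

lemma psd_scaleR: "psd A \<Longrightarrow> 0 \<le> c \<Longrightarrow> psd (c *\<^sub>R A)"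
  by (simp add: psd_def transpose_scalar flip: scaleR_matrix_vector_assoc)

lemma psd_symmetric: "psd A \<Longrightarrow> (A *v v) \<bullet> w = v \<bullet> (A *v w)"
  using transpose_inner[of A v w] by (simp add: psd_def del: transpose_matrix_vector)

lemma psd_Cauchy_Schwarz:
  assumes "psd A"
  shows "((A *v v) \<bullet> w)\<^sup>2 \<le> ((A *v v) \<bullet> v) * ((A *v w) \<bullet> w)"
proof (rule quadratic_nonneg_imp_discrim)
  fix r :: real
  have "0 \<le> (A *v (v + r *\<^sub>R w)) \<bullet> (v + r *\<^sub>R w)" using assms by (simp add: psd_def)
  also have "\<dots> = (A *v v) \<bullet> v + 2 * ((A *v v) \<bullet> w) * r + ((A *v w) \<bullet> w) * r\<^sup>2"
    using psd_symmetric[OF assms, of v w]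
    by (simp add: matrix_vector_right_distrib matrix_vector_mult_scaleR inner_add
        inner_commute power2_eq_square algebra_simps)
  finally show "0 \<le> (A *v v) \<bullet> v + 2 * ((A *v v) \<bullet> w) * r + ((A *v w) \<bullet> w) * r\<^sup>2" .
qed (use assms in \<open>simp add: psd_def\<close>)

text \<open>Cauchy-Schwarz with second vector \<open>A *v u\<close> bounds the fourth power of the
  norm of \<open>A *v u\<close> by 0.\<close>

lemma psd_kernel:
  assumes "psd A" "(A *v u) \<bullet> u = 0"
  shows "A *v u = 0"
  using psd_Cauchy_Schwarz[OF assms(1), of u "A *v u"] assms(2) by simp

lemma psd_diag_nonneg: "psd A \<Longrightarrow> 0 \<le> A $ i $ i"
  unfolding psd_def by (metis matrix_vector_axis_inner)

text \<open>A vanishing diagonal entry puts the basis vector \<open>axis j 1\<close> into the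
  kernel, so its whole column vanishes.\<close>

lemma psd_diag_zero:
  assumes "psd A" "A $ j $ j = 0"
  shows "A $ i $ j = 0"
  using psd_kernel[OF assms(1), of "axis j 1"] assms(2) matrix_vector_axis_inner[of A j]
  by (metis inner_zero_left)

lemma psd_trace_zero:
  assumes "psd A" "mat 1 \<bullet> A = 0"
  shows "A = 0"
proof -
  have "A $ i $ i = 0" for i
    using assms psd_diag_nonneg[OF assms(1)] by (simp add: inner_mat_1 sum_nonneg_eq_0_iff)
  then show ?thesis using psd_diag_zero[OF assms(1)] by (simp add: vec_eq_iff)
qed

text \<open>Subtracting the normalised square of a column is one step of a Cholesky decomposition.\<close>

lemma psd_subtract_column:
  assumes "psd A" "0 < A $ k $ k"
  shows "psd (A - (1 / A $ k $ k) *\<^sub>R outer (A *v axis k 1) (A *v axis k 1))"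
proof -
  let ?w = "A *v axis k 1"
  let ?D = "A - (1 / A $ k $ k) *\<^sub>R outer ?w ?w"
  have "transpose ?D = ?D"
    using assms(1) by (simp add: psd_def transpose_def outer_def vec_eq_iff mult.commute)
  moreover have "0 \<le> (?D *v v) \<bullet> v" for v
  proof -
    have "(?w \<bullet> v)\<^sup>2 \<le> A $ k $ k * ((A *v v) \<bullet> v)"
      using psd_Cauchy_Schwarz[OF assms(1), of "axis k 1" v] by (simp add: matrix_vector_axis_inner)
    then have "(?w \<bullet> v)\<^sup>2 / A $ k $ k \<le> (A *v v) \<bullet> v" using assms(2) by (simp add: field_simps)
    then show ?thesis
      by (simp add: matrix_vector_mult_diff_rdistrib inner_diff_left outer_mult_vec
          power2_eq_square flip: scaleR_matrix_vector_assoc)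
  qed
  ultimately show ?thesis by (simp add: psd_def)
qed

text \<open>A Cholesky step writes \<open>D\<close> as a positive multiple of a rank one matrix,
  whose pairing with \<open>C\<close> is a value of the quadratic form of \<open>C\<close>, plus a
  positive semidefinite matrix with fewer nonzero diagonal entries. Iterating takes the place of a
  spectral decomposition.\<close>

lemma psd_inner_nonneg:
  assumes "psd C" "psd D"
  shows "0 \<le> C \<bullet> D"
  using assms(2)
proof (induction "card {k. D $ k $ k \<noteq> 0}" arbitrary: D rule: less_induct)
  case less
  show ?case
  proof (cases "\<exists>k. D $ k $ k \<noteq> 0")
    case False
    then have "D = 0" using psd_diag_zero[OF less(2)] by (simp add: vec_eq_iff)
    then show ?thesis by simp
  next
    case True
    then obtain k where k: "D $ k $ k \<noteq> 0" by blast
    with psd_diag_nonneg[OF less(2), of k] have pos: "0 < D $ k $ k" by simp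
    let ?w = "D *v axis k 1"
    let ?E = "D - (1 / D $ k $ k) *\<^sub>R outer ?w ?w"
    have w: "?w $ i = D $ i $ k" for i by (simp add: matrix_vector_mult_basis column_def)
    \<comment> \<open>Entry \<open>k\<close> of the diagonal is cleared. A diagonal entry that is
      already 0 stays 0, because its column in \<open>D\<close>, and by symmetry its row,
      vanishes.\<close>
    have "{i. ?E $ i $ i \<noteq> 0} \<subseteq> {i. D $ i $ i \<noteq> 0} - {k}"
      using k psd_diag_zero[OF less(2)] less(2) by (auto simp: outer_def w psd_def transpose_def vec_eq_iff)
    then have "{i. ?E $ i $ i \<noteq> 0} \<subset> {i. D $ i $ i \<noteq> 0}" using k by blast
    then have "card {i. ?E $ i $ i \<noteq> 0} < card {i. D $ i $ i \<noteq> 0}"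
      by (intro psubset_card_mono) auto
    then have "0 \<le> C \<bullet> ?E" using less(1) psd_subtract_column[OF less(2) pos] by blast
    moreover have "0 \<le> C \<bullet> outer ?w ?w" using assms(1) by (simp add: inner_outer psd_def)
    then have "0 \<le> (C \<bullet> outer ?w ?w) / D $ k $ k" using pos by simp
    ultimately show ?thesis by (simp add: inner_diff_right)
  qed
qed

section \<open>States of archimedean quadratic modules\<close>

abbreviation Const :: "real \<Rightarrow> 'n rpoly" where
  "Const c \<equiv> Poly_Mapping.single 0 c"

section \<open>Scalar multiples and linearity of states\<close>

lemma mat_add_mult: "mat (f + g) ** p = mat f ** p + mat g ** p"
  for f g :: "'a::semiring_1" and p :: "'a ^ 'n ^ 'm::finite"
  by (simp add: vec_eq_iff mat_mult_nth distrib_right)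

lemma mat_diff_mult: "mat (f - g) ** p = mat f ** p - mat g ** p"
  for f g :: "'a::ring_1" and p :: "'a ^ 'n ^ 'm::finite"
  by (simp add: vec_eq_iff mat_mult_nth left_diff_distrib)

lemma mat_mult_add: "mat f ** (p + q) = mat f ** p + mat f ** q"
  for f :: "'a::semiring_1" and p :: "'a ^ 'n ^ 'm::finite"
  by (simp add: vec_eq_iff mat_mult_nth distrib_left)

lemma mat_mult_diff: "mat f ** (p - q) = mat f ** p - mat f ** q"
  for f :: "'a::ring_1" and p :: "'a ^ 'n ^ 'm::finite"
  by (simp add: vec_eq_iff mat_mult_nth right_diff_distrib)

lemma state_add: "L \<in> states M \<Longrightarrow> p \<in> Sym \<Longrightarrow> q \<in> Sym \<Longrightarrow> L (p + q) = L p + L q"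
  by (simp add: states_def)

lemma state_scale: "L \<in> states M \<Longrightarrow> p \<in> Sym \<Longrightarrow> L (mat (Const c) ** p) = c * L p"
  by (simp add: states_def scalar_def)

lemma state_one: "L \<in> states M \<Longrightarrow> L (mat 1) = 1"
  by (simp add: states_def)

lemma state_nonneg: "L \<in> states M \<Longrightarrow> p \<in> M \<Longrightarrow> 0 \<le> L p"
  by (simp add: states_def)

lemma state_diff:
  assumes "L \<in> states M" "p \<in> Sym" "q \<in> Sym"
  shows "L (p - q) = L p - L q"
  using state_add[OF assms(1) Sym_diff[OF assms(2,3)] assms(3)] by simp

lemma state_zero: "L \<in> states M \<Longrightarrow> L 0 = 0"
  using state_add[of L M 0 0] by simp

lemma state_sum:
  assumes "L \<in> states M" "\<And>i. i \<in> A \<Longrightarrow> f i \<in> Sym"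
  shows "L (\<Sum>i\<in>A. f i) = (\<Sum>i\<in>A. L (f i))"
  using assms(2)
proof (induction A rule: infinite_finite_induct)
  case (insert a A)
  then have "L (f a + sum f A) = L (f a) + L (sum f A)" by (intro state_add[OF assms(1)]) auto
  with insert show ?case by simp
qed (simp_all add: state_zero[OF assms(1)])

lemma state_poly_add:
  "L \<in> states M \<Longrightarrow> p \<in> Sym \<Longrightarrow> L (mat (f + g) ** p) = L (mat f ** p) + L (mat g ** p)"
  by (simp add: mat_add_mult state_add Sym_mat_mult)

lemma state_poly_diff:
  "L \<in> states M \<Longrightarrow> p \<in> Sym \<Longrightarrow> L (mat (f - g) ** p) = L (mat f ** p) - L (mat g ** p)"
  by (simp add: mat_diff_mult state_diff Sym_mat_mult)

lemma state_poly_scale: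
  "L \<in> states M \<Longrightarrow> p \<in> Sym \<Longrightarrow> L (mat (Const c * f) ** p) = c * L (mat f ** p)"
  using state_scale[of L M "mat f ** p" c] by (simp add: mat_mult_mat Sym_mat_mult)

lemma state_eqI:
  assumes "L \<in> states M" "L' \<in> states M'" "\<And>p. p \<in> Sym \<Longrightarrow> L p = L' p"
  shows "L = L'"
  using assms by (intro extensionalityI[of L Sym L']) (auto simp: states_def)

lemma restrict_stateI:
  assumes "M \<subseteq> Sym"
    and "\<And>p q. p \<in> Sym \<Longrightarrow> q \<in> Sym \<Longrightarrow> F (p + q) = F p + F q"
    and "\<And>c p. p \<in> Sym \<Longrightarrow> F (mat (Const c) ** p) = c * F p"
    and "\<And>p. p \<in> M \<Longrightarrow> 0 \<le> F p" and "F (mat 1) = 1"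
  shows "(\<lambda>p\<in>Sym. F p) \<in> states M"
  using assms unfolding states_def scalar_def by (auto simp: Sym_add Sym_mat_mult)

text \<open>For fixed \<open>p\<close> in the quadratic module, sending \<open>f\<close> and
  \<open>g\<close> to \<open>L (mat (f * g) ** p)\<close> is a positive semidefinite symmetric
  bilinear form on scalar polynomials.\<close>

lemma qm_Cauchy_Schwarz:
  assumes "G \<subseteq> Sym" "L \<in> states (quad_module G)" "p \<in> quad_module G"
  shows "(L (mat (f * g) ** p))\<^sup>2 \<le> L (mat (f * f) ** p) * L (mat (g * g) ** p)"
proof (rule quadratic_nonneg_imp_discrim)
  have p: "p \<in> Sym" using assms qm_subset_Sym by blast
  note lin = state_poly_add[OF assms(2) p] state_poly_scale[OF assms(2) p]
  fix r :: real
  have e: "(f + Const r * g) * (f + Const r * g) = f * f + Const (2 * r) * (f * g) + Const (r * r) * (g * g)"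
  proof -
    have "(f + a * g) * (f + a * g) = f * f + (a + a) * (f * g) + a * a * (g * g)" for a
      by (simp add: algebra_simps)
    from this[of "Const r"] show ?thesis by (simp only: mult_2 single_add mult_single add_0)
  qed
  have "0 \<le> L (mat ((f + Const r * g) * (f + Const r * g)) ** p)"
    by (intro state_nonneg[OF assms(2)] qm_square_mult assms)
  then show "0 \<le> L (mat (f * f) ** p) + 2 * L (mat (f * g) ** p) * r + L (mat (g * g) ** p) * r\<^sup>2"
    unfolding e lin by (simp add: power2_eq_square algebra_simps)
qed (intro state_nonneg[OF assms(2)] qm_square_mult assms)

text \<open>The archimedean property bounds only the square of \<open>p\<close>. Adding the square
  of \<open>p - 1/2\<close>, which is \<open>p^2 - p + 1/4\<close>, to \<open>N - p^2\<close> leaves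
  \<open>N + 1/4 - p\<close>.\<close>

lemma archimedean_bound:
  assumes "archimedean (quad_module G)" "p \<in> Sym"
  obtains c where "0 \<le> c" "mat (Const c) - p \<in> quad_module G"
proof -
  obtain N :: nat where N: "scalar (real N) - transpose p ** p \<in> quad_module G"
    using assms(1) unfolding archimedean_def by blast
  let ?h = "mat (Const (1/2)) :: ('a, 'b) matpoly"
  have "transpose (p - ?h) ** (p - ?h) \<in> quad_module G" by (rule qm_square)
  moreover have "transpose (p - ?h) ** (p - ?h) = transpose p ** p - p + mat (Const (1/4))"
  proof -
    have [simp]: "transpose p = p" using assms(2) by (simp add: Sym_def)
    have "transpose (p - ?h) = p - ?h" using Sym_diff[OF assms(2), of ?h] by (simp add: Sym_def)
    then have "transpose (p - ?h) ** (p - ?h) = (p - ?h) ** p - (p - ?h) ** ?h"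
      by (simp add: matrix_matrix_mult_def vec_eq_iff sum_subtractf right_diff_distrib)
    also have "\<dots> = p ** p - ?h ** p - (?h ** p - ?h ** ?h)"
      unfolding mat_commute[of "p - ?h"] mat_mult_diff
      by (simp add: matrix_matrix_mult_def vec_eq_iff sum_subtractf left_diff_distrib)
    also have "\<dots> = p ** p - (mat (Const (1/2) + Const (1/2)) ** p) + ?h ** ?h"
      unfolding mat_add_mult by (simp add: algebra_simps)
    also have "Const (1/2) + Const (1/2) = (1 :: 'a rpoly)" by (simp flip: single_add)
    also have "?h ** ?h = mat (Const (1/4))"
      using mat_mult_mat[of "Const (1/2)" "Const (1/2)" "mat 1"] by (simp add: mult_single)
    finally show ?thesis by simp
  qed
  ultimately have "transpose p ** p - p + mat (Const (1/4)) \<in> quad_module G" by simp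
  from qm_add[OF N this]
  have "scalar (real N) - transpose p ** p + (transpose p ** p - p + mat (Const (1/4)))
      \<in> quad_module G" .
  also have "scalar (real N) - transpose p ** p + (transpose p ** p - p + mat (Const (1/4)))
      = mat (Const (real N + 1/4)) - p"
    by (simp add: scalar_def single_add vec_eq_iff mat_def)
  finally show ?thesis by (intro that[of "real N + 1/4"]) auto
qed

text \<open>If \<^term>\<open>s 1\<close> were larger, the hypothesis on doubled indices would make the values at
  powers of two outgrow the geometric bound.\<close>

lemma doubling_bound:
  fixes s :: "nat \<Rightarrow> real"
  assumes nonneg: "\<And>n. 0 \<le> s n" and double: "\<And>n. (s n)\<^sup>2 \<le> s 0 * s (2 * n)"
    and bound: "\<And>n. s n \<le> C * N ^ n" and "0 < N"
  shows "s 1 \<le> N * s 0"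
proof (rule ccontr)
  assume a: "\<not> ?thesis"
  have "s 0 \<noteq> 0" using a double[of 1] nonneg[of 1] by auto
  then have s0: "0 < s 0" using nonneg[of 0] by simp
  \<comment> \<open>The factor by which \<open>s 1\<close> exceeds the claimed bound; its powers
    will outgrow the constant \<open>C / s 0\<close>.\<close>
  define q where "q = s 1 / (N * s 0)"
  have q: "1 < q" using a s0 \<open>0 < N\<close> by (simp add: q_def)
  have grow: "s 0 * (q * N) ^ (2 ^ k) \<le> s (2 ^ k)" for k
  proof (induction k)
    case 0
    then show ?case using s0 \<open>0 < N\<close> by (simp add: q_def)
  next
    case (Suc k)
    have "s 0 * (s 0 * (q * N) ^ (2 ^ Suc k)) = (s 0 * (q * N) ^ (2 ^ k))\<^sup>2"
      by (simp add: power_mult_distrib power2_eq_square power_add mult_2)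
    also have "\<dots> \<le> (s (2 ^ k))\<^sup>2"
      using Suc s0 q \<open>0 < N\<close> by (intro power_mono) auto
    also have "\<dots> \<le> s 0 * s (2 ^ Suc k)" using double[of "2 ^ k"] by simp
    finally show ?case using s0 by simp
  qed
  obtain k where k: "C / s 0 < q ^ k" using real_arch_pow[OF q] by blast
  note k
  also have "q ^ k \<le> q ^ (2 ^ k)"
    using q by (intro power_increasing) (simp_all add: less_imp_le)
  finally have "C / s 0 < q ^ (2 ^ k)" .
  moreover have "s 0 * q ^ (2 ^ k) * N ^ (2 ^ k) \<le> C * N ^ (2 ^ k)"
    using order_trans[OF grow bound, of k] by (simp add: power_mult_distrib mult.assoc)
  then have "q ^ (2 ^ k) \<le> C / s 0"
    using s0 \<open>0 < N\<close> by (simp add: field_simps)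
  ultimately show False by simp
qed

text \<open>The product of \<open>N - f^2\<close> with \<open>p\<close> is not known to lie in the
  quadratic module, so positivity cannot be applied to it directly. Instead
  \<open>doubling_bound\<close> is applied to the values of \<open>L\<close> at
  \<open>f^(2n) p\<close>: Cauchy-Schwarz gives the doubling hypothesis, and \<open>c - p\<close> in
  the module together with \<open>L(f^(2n)) \<le> N^n\<close> gives the geometric bound.\<close>

lemma state_square_bound:
  assumes G: "G \<subseteq> Sym" "archimedean (quad_module G)" and L: "L \<in> states (quad_module G)"
    and N: "mat (Const N) - mat (f * f) \<in> quad_module G" "0 < N" and p: "p \<in> quad_module G"
  shows "L (mat (f * f) ** p) \<le> N * L p"
proof -
  have pS: "p \<in> Sym" using G(1) p qm_subset_Sym by blast
  have sq: "(f * f) ^ n = f ^ n * f ^ n" for n by (simp add: power_mult_distrib)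
  have pow: "L (mat ((f * f) ^ n)) \<le> N ^ n" for n
  proof (induction n)
    case (Suc n)
    have "0 \<le> L (mat ((f * f) ^ n) ** (mat (Const N) - mat (f * f)))"
      unfolding sq by (intro state_nonneg[OF L] qm_square_mult N)
    also have "mat ((f * f) ^ n) ** (mat (Const N) - mat (f * f))
        = mat (Const N * (f * f) ^ n) ** mat 1 - mat ((f * f) ^ Suc n) ** mat 1"
      by (simp add: vec_eq_iff mat_mult_nth) (simp add: mat_def algebra_simps)
    also have "L \<dots> = N * L (mat ((f * f) ^ n)) - L (mat ((f * f) ^ Suc n))"
      by (subst state_diff[OF L]) (simp_all add: state_poly_scale[OF L] Sym_mat_mult del: power_Suc matrix_mul_rid, simp)
    finally have "L (mat ((f * f) ^ Suc n)) \<le> N * L (mat ((f * f) ^ n))" by simp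
    also have "\<dots> \<le> N * N ^ n" using Suc N(2) by simp
    finally show ?case by simp
  qed (simp add: state_one[OF L])
  obtain c where c: "0 \<le> c" "mat (Const c) - p \<in> quad_module G"
    using archimedean_bound[OF G(2) pS] by blast
  \<comment> \<open>The exponents 1 and 0 are kept explicit to match \<open>s 1\<close> and
    \<open>s 0\<close> in \<open>doubling_bound\<close>.\<close>
  have "L (mat ((f * f) ^ 1) ** p) \<le> N * L (mat ((f * f) ^ 0) ** p)"
  proof (rule doubling_bound)
    fix n
    show "0 \<le> L (mat ((f * f) ^ n) ** p)"
      unfolding sq by (intro state_nonneg[OF L] qm_square_mult p)
    show "(L (mat ((f * f) ^ n) ** p))\<^sup>2
        \<le> L (mat ((f * f) ^ 0) ** p) * L (mat ((f * f) ^ (2 * n)) ** p)"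
      using qm_Cauchy_Schwarz[OF G(1) L p, of 1 "(f * f) ^ n"] by (simp add: mult_2 power_add)
    have "0 \<le> L (mat ((f * f) ^ n) ** (mat (Const c) - p))"
      unfolding sq by (intro state_nonneg[OF L] qm_square_mult c)
    also have "\<dots> = c * L (mat ((f * f) ^ n)) - L (mat ((f * f) ^ n) ** p)"
      unfolding mat_mult_diff
      using state_scale[OF L, of "mat ((f * f) ^ n)" c] pS
      by (subst state_diff[OF L]) (simp_all add: Sym_mat_mult mat_commute[of _ "Const c"])
    also have "\<dots> \<le> c * N ^ n - L (mat ((f * f) ^ n) ** p)"
      using pow c(1) by (simp add: mult_left_mono)
    finally show "L (mat ((f * f) ^ n) ** p) \<le> c * N ^ n" by simp
  qed (rule N)
  then show ?thesis by simp
qed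

text \<open>Take \<open>p = c - (c - p)\<close> for a large constant \<open>c\<close>. Linear
  identities on the quadratic module thereby extend to \<open>Sym\<close>.\<close>

lemma Sym_eq_qm_diff:
  assumes "archimedean (quad_module G)" "p \<in> Sym"
  obtains a b where "a \<in> quad_module G" "b \<in> quad_module G" "p = a - b"
proof -
  obtain c where c: "0 \<le> c" "mat (Const c) - p \<in> quad_module G"
    using archimedean_bound[OF assms] by blast
  have "mat (Const c) \<in> quad_module G"
    using qm_const_mult[OF qm_generator[of "mat 1" G "mat 1"] c(1)] by simp
  from this c(2) show ?thesis by (rule that) simp
qed

text \<open>For \<open>m\<close> in the quadratic module, \<open>L(f^2 m)\<close> lies between 0 and
  \<open>c L(f^2) = 0\<close>, and Cauchy-Schwarz against the constant 1 then gives
  \<open>L(f m) = 0\<close>. Differences of such \<open>m\<close> exhaust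
  \<open>Sym\<close>.\<close>

lemma state_square_vanish:
  assumes G: "G \<subseteq> Sym" "archimedean (quad_module G)" and L: "L \<in> states (quad_module G)"
    and f: "L (mat (f * f)) = 0" and p: "p \<in> Sym"
  shows "L (mat (f * f) ** p) = 0" "L (mat f ** p) = 0"
proof -
  have qm: "L (mat (f * f) ** m) = 0 \<and> L (mat f ** m) = 0" if m: "m \<in> quad_module G" for m
  proof -
    have mS: "m \<in> Sym" using G(1) m qm_subset_Sym by blast
    obtain c where c: "0 \<le> c" "mat (Const c) - m \<in> quad_module G"
      using archimedean_bound[OF G(2) mS] by blast
    have "0 \<le> L (mat (f * f) ** (mat (Const c) - m))"
      by (intro state_nonneg[OF L] qm_square_mult c)
    also have "\<dots> = c * L (mat (f * f)) - L (mat (f * f) ** m)"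
      unfolding mat_mult_diff
      using state_scale[OF L, of "mat (f * f)" c] mS
      by (subst state_diff[OF L]) (simp_all add: Sym_mat_mult mat_commute[of _ "Const c"])
    finally have "L (mat (f * f) ** m) \<le> 0" using f by simp
    moreover have "0 \<le> L (mat (f * f) ** m)" by (intro state_nonneg[OF L] qm_square_mult m)
    ultimately have "L (mat (f * f) ** m) = 0" by simp
    moreover from this have "L (mat f ** m) = 0"
      using qm_Cauchy_Schwarz[OF G(1) L m, of f 1] by simp
    ultimately show ?thesis by simp
  qed
  obtain a b where ab: "a \<in> quad_module G" "b \<in> quad_module G" "p = a - b"
    using Sym_eq_qm_diff[OF G(2) p] .
  then have S: "a \<in> Sym" "b \<in> Sym" using G(1) qm_subset_Sym by blast+
  show "L (mat (f * f) ** p) = 0" "L (mat f ** p) = 0"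
    using qm[OF ab(1)] qm[OF ab(2)] unfolding ab(3) mat_mult_diff
    by (simp_all add: state_diff[OF L] Sym_mat_mult S)
qed

section \<open>Multiplicativity of pure states\<close>

text \<open>Boundedness of \<open>f\<^sup>2\<close> splits \<open>L\<close> into a convex combination of two states, the first of which is
  a multiple of \<open>L (f\<^sup>2 \<cdot>)\<close>.\<close>

lemma pure_state_mult_square:
  assumes G: "G \<subseteq> Sym" "archimedean (quad_module G)" and L: "L \<in> pure_states (quad_module G)"
    and p: "p \<in> Sym"
  shows "L (mat (f * f) ** p) = L (mat (f * f)) * L p"
proof -
  have Ls: "L \<in> states (quad_module G)" using L by (simp add: pure_states_def)
  note MS = qm_subset_Sym[OF G(1)]
  define c where "c = L (mat (f * f))"
  obtain N :: nat where N: "1 \<le> N" "scalar (real N) - transpose (mat f) ** mat f \<in> quad_module G"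
    using G(2) unfolding archimedean_def by blast
  have "mat f ** mat f = (mat (f * f) :: ('a, 'b) matpoly)"
    using mat_mult_mat[of f f "mat 1"] by simp
  with N have N': "mat (Const (real N)) - mat (f * f) \<in> quad_module G"
    by (simp add: scalar_def)
  have c0: "0 \<le> c" unfolding c_def
    using state_nonneg[OF Ls qm_square_mult[OF qm_generator[of "mat 1" G "mat 1"]]] by simp
  have bound: "L (mat (f * f) ** m) \<le> real N * L m" if "m \<in> quad_module G" for m
    using state_square_bound[OF G Ls N' _ that] N(1) by simp
  have cN: "c \<le> real N"
    using bound[OF qm_generator[of "mat 1" G "mat 1"]] by (simp add: c_def state_one[OF Ls])
  show ?thesis
  proof (cases "c = 0")
    case True
    then show ?thesis using state_square_vanish[OF G Ls _ p, of f] by (simp add: c_def)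
  next
    case False
    with c0 have c: "0 < c" by simp
    \<comment> \<open>One more than \<open>N\<close>, so that \<open>c < D\<close> strictly and both
      weights \<open>c / D\<close> and \<open>1 - c / D\<close> are positive.\<close>
    define D where "D = real N + 1"
    have D: "c < D" "0 < D" using cN by (simp_all add: D_def)
    have comm: "mat (f * f) ** (mat (Const r) ** q) = mat (Const r) ** (mat (f * f) ** q)"
      for r and q :: "('a, 'b) matpoly"
      by (simp add: mat_mult_mat mult.commute)
    define L1 where "L1 = (\<lambda>p\<in>Sym. L (mat (f * f) ** p) / c)"
    define L2 where "L2 = (\<lambda>p\<in>Sym. (D * L p - L (mat (f * f) ** p)) / (D - c))"
    have "L1 \<in> states (quad_module G)" unfolding L1_def
    proof (rule restrict_stateI[OF MS])
      show "0 \<le> L (mat (f * f) ** m) / c" if "m \<in> quad_module G" for m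
        using state_nonneg[OF Ls qm_square_mult[OF that]] c by simp
    qed (use c in \<open>simp_all add: mat_mult_add comm state_add[OF Ls] state_scale[OF Ls]
        Sym_mat_mult add_divide_distrib\<close>, simp add: c_def)
    moreover have "L2 \<in> states (quad_module G)" unfolding L2_def
    proof (rule restrict_stateI[OF MS])
      show "0 \<le> (D * L m - L (mat (f * f) ** m)) / (D - c)" if "m \<in> quad_module G" for m
        using bound[OF that] state_nonneg[OF Ls that] D by (simp add: D_def algebra_simps)
      show "(D * L (mat 1) - L (mat (f * f) ** mat 1)) / (D - c) = 1"
        using D by (simp add: state_one[OF Ls] flip: c_def)
    qed (simp_all add: mat_mult_add comm state_add[OF Ls] state_scale[OF Ls]
        Sym_mat_mult right_diff_distrib distrib_left diff_divide_distrib add_divide_distrib)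
    moreover have "\<forall>p\<in>Sym. L p = c / D * L1 p + (1 - c / D) * L2 p"
      using c D by (simp add: L1_def L2_def field_simps)
    moreover have "0 < c / D" "c / D < 1" using c D by simp_all
    ultimately have "L1 = L" using L unfolding pure_states_def by blast
    then have "L p = L1 p" by simp
    then show ?thesis using p c by (simp add: L1_def c_def)
  qed
qed

text \<open>Polarization: \<open>4 f = (f + 1)^2 - (f - 1)^2\<close>, so multiplicativity for
  squares passes to every \<open>f\<close>.\<close>

lemma pure_state_mult:
  assumes G: "G \<subseteq> Sym" "archimedean (quad_module G)" and L: "L \<in> pure_states (quad_module G)"
    and p: "p \<in> Sym"
  shows "L (mat f ** p) = L (mat f) * L p"
proof -
  have Ls: "L \<in> states (quad_module G)" using L by (simp add: pure_states_def)
  define g where "g = (f + 1) * (f + 1)"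
  define h where "h = (f - 1) * (f - 1)"
  have f: "f = Const (1/4) * (g - h)"
  proof -
    have "g - h = Const 4 * f"
      by (simp add: g_def h_def algebra_simps)
    moreover have "Const (1/4) * Const 4 = (1 :: 'a rpoly)"
      by (simp add: mult_single del: single_numeral)
    ultimately show ?thesis by (simp only: mult.assoc[symmetric] mult_1)
  qed
  have e: "L (mat f ** q) = (L (mat g ** q) - L (mat h ** q)) / 4" if "q \<in> Sym" for q
    by (subst f) (simp add: state_poly_scale[OF Ls that] state_poly_diff[OF Ls that])
  have "L (mat g ** p) = L (mat g) * L p" "L (mat h ** p) = L (mat h) * L p"
    unfolding g_def h_def by (rule pure_state_mult_square[OF G L p])+
  moreover have "L (mat f) = (L (mat g) - L (mat h)) / 4" using e[of "mat 1"] by simp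
  ultimately show ?thesis
    unfolding e[OF p] by (simp only: left_diff_distrib times_divide_eq_left)
qed

section \<open>Density matrices\<close>

text \<open>Symmetrised matrix units. The factor 1/2 lets the expansion of a symmetric matrix run
  over all ordered pairs of indices, with its entries as coefficients.\<close>

definition sym_unit :: "'t \<Rightarrow> 't \<Rightarrow> real ^ 't ^ 't::finite" where
  "sym_unit i j = (1/2) *\<^sub>R (outer (axis i 1) (axis j 1) + outer (axis j 1) (axis i 1))"

lemma sym_unit_symmetric: "transpose (sym_unit i j) = sym_unit i j"
  by (simp add: sym_unit_def transpose_scalar transpose_add transpose_outer add.commute)

lemma sym_unit_commute: "sym_unit i j = sym_unit j i"
  by (simp add: sym_unit_def add.commute)

lemma sym_unit_nth:
  "sym_unit i j $ k $ l = (if l = j then if k = i then 1/2 else 0 else 0)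
    + (if k = j then if l = i then 1/2 else 0 else 0)"
  by (auto simp: sym_unit_def outer_def axis_def)

lemma Sym_expansion:
  assumes "p \<in> Sym"
  shows "p = (\<Sum>i\<in>UNIV. \<Sum>j\<in>UNIV. mat (p $ i $ j) ** cmat (sym_unit i j))"
proof -
  have half: "a * Const (1/2) + a * Const (1/2) = a" for a :: "'a rpoly"
    by (simp flip: distrib_left single_add)
  have "(\<Sum>i\<in>UNIV. \<Sum>j\<in>UNIV. mat (p $ i $ j) ** cmat (sym_unit i j)) $ k $ l
      = p $ k $ l * Const (1/2) + p $ l $ k * Const (1/2)" for k l
    by (simp add: mat_mult_nth cmat_def sym_unit_nth single_add distrib_left sum.distrib
        if_distrib[of "Poly_Mapping.single 0"] if_distrib[of "\<lambda>x. _ * x"] cong: if_cong)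
  moreover have "p $ l $ k = p $ k $ l" for k l using assms by (simp add: Sym_iff)
  ultimately show ?thesis using half by (simp add: vec_eq_iff)
qed

text \<open>The candidate density matrix. Symmetrised units are used because a state is meaningful
  only on \<open>Sym\<close>.\<close>

definition state_matrix :: "(('n::finite, 't::finite) matpoly \<Rightarrow> real) \<Rightarrow> real ^ 't ^ 't" where
  "state_matrix L = (\<chi> i j. L (cmat (sym_unit i j)))"

text \<open>Multiplicativity in the variables makes every scalar polynomial act as its value at
  \<open>x\<close>. By \<open>Sym_expansion\<close> only the values of \<open>L\<close> on the
  symmetrised units remain.\<close>

lemma state_at_point:
  assumes L: "L \<in> states M"
    and X: "\<And>i p. p \<in> Sym \<Longrightarrow> L (mat (Var i) ** p) = x $ i * L p" and p: "p \<in> Sym"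
  shows "L p = mat_eval p x \<bullet> state_matrix L"
proof -
  \<comment> \<open>\<open>q\<close> varies in the induction: for a product \<open>f * g\<close> the
    claim for \<open>f\<close> is applied to \<open>mat g ** q\<close>.\<close>
  have mult: "L (mat f ** q) = poly_eval f x * L q" if "q \<in> Sym" for f q
    using that
  proof (induction f arbitrary: q rule: poly_ring_induct)
    case (mult f g)
    then show ?case
      using mult.IH(1)[of "mat g ** q"] mult.IH(2)[of q] by (simp add: mat_mult_mat Sym_mat_mult)
  qed (simp_all add: state_scale[OF L] X state_poly_add[OF L] distrib_right)
  have S: "cmat (sym_unit i j) \<in> Sym" for i j
    by (rule cmat_Sym[OF sym_unit_symmetric])
  have "L p = L (\<Sum>i\<in>UNIV. \<Sum>j\<in>UNIV. mat (p $ i $ j) ** cmat (sym_unit i j))"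
    using Sym_expansion[OF p] by simp
  also have "\<dots> = (\<Sum>i\<in>UNIV. \<Sum>j\<in>UNIV. poly_eval (p $ i $ j) x * L (cmat (sym_unit i j)))"
    by (simp add: state_sum[OF L] Sym_sum Sym_mat_mult S mult)
  finally show ?thesis by (simp add: inner_vec_def mat_eval_def state_matrix_def)
qed

text \<open>With the unit vector \<open>e\<close> at an arbitrary index \<open>k\<close>, the
  product of the transpose of \<open>e v^T\<close> with \<open>e v^T\<close> is
  \<open>v (e^T e) v^T = v v^T\<close>. A rank one matrix is thus a square within the square
  matrices.\<close>

lemma cmat_outer_square: "cmat (outer v v) = transpose (cmat (outer (axis k 1) v)) ** cmat (outer (axis k 1) v)"
proof -
  have "Const (\<Sum>l\<in>A. h l) = (\<Sum>l\<in>A. Const (h l))" for h :: "'b \<Rightarrow> real" and A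
    by (induction A rule: infinite_finite_induct) (simp_all add: single_add)
  note sum_Const = this[symmetric]
  show ?thesis
    by (simp add: vec_eq_iff cmat_def transpose_def matrix_matrix_mult_def outer_def mult_single
        sum_Const axis_def if_distrib[of "\<lambda>x. x * _"] cong: if_cong)
qed

lemma cmat_outer_qm: "cmat (outer v v) \<in> quad_module G"
  using qm_square[of "cmat (outer (axis undefined 1) v)" G]
  by (simp flip: cmat_outer_square)

text \<open>The quadratic form of the matrix at \<open>v\<close> is the value of \<open>L\<close> at
  the constant matrix \<open>outer v v\<close>, which is a square.\<close>

lemma psd_state_matrix:
  assumes L: "L \<in> states (quad_module G)"
    and X: "\<And>i p. p \<in> Sym \<Longrightarrow> L (mat (Var i) ** p) = x $ i * L p"
  shows "psd (state_matrix L)"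
proof -
  have "(state_matrix L *v v) \<bullet> v = L (cmat (outer v v))" for v
    using state_at_point[OF L X cmat_Sym[OF transpose_outer, of v]]
    by (simp add: inner_outer inner_commute)
  moreover have "0 \<le> L (cmat (outer v v))" for v
    by (intro state_nonneg[OF L] cmat_outer_qm)
  moreover have "transpose (state_matrix L) = state_matrix L"
    by (simp add: state_matrix_def transpose_def vec_eq_iff sym_unit_commute)
  ultimately show ?thesis by (simp add: psd_def)
qed

lemma trace_state_matrix:
  assumes L: "L \<in> states M"
    and X: "\<And>i p. p \<in> Sym \<Longrightarrow> L (mat (Var i) ** p) = x $ i * L p"
  shows "mat 1 \<bullet> state_matrix L = 1"
  using state_at_point[OF L X, of "mat 1"] by (simp add: state_one[OF L])

section \<open>States given by a point and a density matrix\<close>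

lemma psd_add: "psd A \<Longrightarrow> psd B \<Longrightarrow> psd (A + B)"
  by (simp add: psd_def transpose_add matrix_vector_mult_add_rdistrib inner_add_left)

lemma psd_congruence: "psd A \<Longrightarrow> psd (transpose P ** A ** P)"
proof -
  assume A: "psd A"
  have "((transpose P ** A ** P) *v v) \<bullet> v = (A *v (P *v v)) \<bullet> (P *v v)" for v
    by (simp add: transpose_inner del: transpose_matrix_vector flip: matrix_vector_mul_assoc)
  then show ?thesis using A by (simp add: psd_def matrix_transpose_mul matrix_mul_assoc)
qed

lemma psd_mat_1: "psd (mat 1)"
  by (simp add: psd_def)

lemma qm_eval_psd:
  assumes "x \<in> pos_set G" "m \<in> quad_module G"
  shows "psd (mat_eval m x)"
  using assms(2)
proof (induction rule: qm_induct)
  case (generator g p)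
  then have "psd (mat_eval g x)" using assms(1) psd_mat_1 by (auto simp: pos_set_def)
  then show ?case by (simp add: psd_congruence)
qed (simp add: psd_add)

text \<open>Positivity is the nonnegativity of the inner product of two positive semidefinite
  matrices. Matrices \<open>B\<close> of higher rank are needed for the second summand when a
  density matrix is decomposed.\<close>

lemma density_state:
  assumes "G \<subseteq> Sym" "x \<in> pos_set G" "psd B" "mat 1 \<bullet> B = 1"
  shows "(\<lambda>p\<in>Sym. mat_eval p x \<bullet> B) \<in> states (quad_module G)"
proof (rule restrict_stateI[OF qm_subset_Sym[OF assms(1)]])
  have "mat c ** A = c *\<^sub>R A" for c and A :: "real ^ 'b ^ 'b"
    by (simp add: vec_eq_iff mat_mult_nth)
  then show "mat_eval (mat (Const c) ** p) x \<bullet> B = c * (mat_eval p x \<bullet> B)" for c p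
    by simp
  show "0 \<le> mat_eval m x \<bullet> B" if "m \<in> quad_module G" for m
    using psd_inner_nonneg[OF qm_eval_psd[OF assms(2) that] assms(3)] .
qed (simp_all add: inner_add_left assms(4))

lemma vec_state_alt: "vec_state x v = (\<lambda>p\<in>Sym. mat_eval p x \<bullet> outer v v)"
  by (simp add: vec_state_def inner_outer)

lemma vec_state_state:
  assumes "G \<subseteq> Sym" "x \<in> pos_set G" "norm v = 1"
  shows "vec_state x v \<in> states (quad_module G)"
  unfolding vec_state_alt
  by (intro density_state[OF assms(1,2) psd_outer]) (simp add: inner_mat_1_outer assms(3) flip: norm_eq_1)

text \<open>Testing \<open>L\<close> on \<open>P\<^sup>T g P\<close> with \<open>P = v e\<^sub>k\<^sup>T\<close> isolates the value of the form \<open>g(x)\<close>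
  at \<open>v\<close>, weighted by \<open>B\<^sub>k\<^sub>k\<close>.\<close>

lemma density_point_pos_set:
  assumes "G \<subseteq> Sym" and L: "L \<in> states (quad_module G)"
    and eval: "\<And>p. p \<in> Sym \<Longrightarrow> L p = mat_eval p x \<bullet> B" and k: "0 < B $ k $ k"
  shows "x \<in> pos_set G"
  unfolding pos_set_def mem_Collect_eq psd_def
proof (intro ballI conjI allI)
  fix g v assume g: "g \<in> G"
  then have gS: "g \<in> Sym" using assms(1) by blast
  then show "transpose (mat_eval g x) = mat_eval g x"
    by (simp add: Sym_def flip: mat_eval_transpose)
  let ?P = "outer v (axis k 1) :: real ^ 'b ^ 'b"
  let ?q = "transpose (cmat ?P) ** g ** cmat ?P"
  have "?q \<in> quad_module G" using g by (intro qm_generator) simp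
  then have "0 \<le> L ?q" by (rule state_nonneg[OF L])
  also have "L ?q = mat_eval ?q x \<bullet> B" by (intro eval Sym_congruence gS)
  also have "mat_eval ?q x = ((mat_eval g x *v v) \<bullet> v) *\<^sub>R outer (axis k 1) (axis k 1)"
  proof -
    have "(transpose ?P ** A ** ?P) $ i $ j = ((A *v v) \<bullet> v) * (axis k 1 $ i * axis k 1 $ j)" for A i j
      by (simp add: matrix_matrix_mult_def matrix_vector_mult_def inner_vec_def transpose_def
          outer_def sum_distrib_left sum_distrib_right algebra_simps)
        (subst sum.swap, simp add: mult.left_commute)
    then show ?thesis by (simp add: vec_eq_iff) (simp add: outer_def)
  qed
  also have "\<dots> \<bullet> B = ((mat_eval g x *v v) \<bullet> v) * B $ k $ k"
    using matrix_vector_axis_inner[of B k k] inner_outer[of B "axis k 1"]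
    by (simp add: inner_commute)
  finally show "0 \<le> (mat_eval g x *v v) \<bullet> v" using k by (simp add: zero_le_mult_iff)
qed

section \<open>Pure states are exactly the vector states\<close>

lemma pure_state_is_vec_state:
  assumes G: "G \<subseteq> Sym" "archimedean (quad_module G)" and L: "L \<in> pure_states (quad_module G)"
  obtains x v where "x \<in> pos_set G" "norm v = 1" "L = vec_state x v"
proof -
  have Ls: "L \<in> states (quad_module G)" using L by (simp add: pure_states_def)
  define x where "x = (\<chi> i. L (mat (Var i)))"
  have X: "L (mat (Var i) ** p) = x $ i * L p" if "p \<in> Sym" for i p
    using pure_state_mult[OF G L that] by (simp add: x_def)
  define B where "B = state_matrix L"
  have eval: "L p = mat_eval p x \<bullet> B" if "p \<in> Sym" for p
    unfolding B_def using Ls X that by (rule state_at_point)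
  have B: "psd B" "mat 1 \<bullet> B = 1" unfolding B_def
    using psd_state_matrix[OF Ls X] trace_state_matrix[OF Ls X] by auto
  have "\<exists>k. B $ k $ k \<noteq> 0"
  proof (rule ccontr)
    assume "\<not> ?thesis"
    with B(2) show False by (simp add: inner_mat_1)
  qed
  then obtain k where k: "0 < B $ k $ k"
    using psd_diag_nonneg[OF B(1)] by (metis order_le_less)
  have x: "x \<in> pos_set G" using density_point_pos_set[OF G(1) Ls eval k] .
  define w where "w = B *v axis k 1"
  have "w $ k = B $ k $ k" by (simp add: w_def matrix_vector_mult_basis column_def)
  with k have w0: "w \<noteq> 0" by auto
  define v where "v = (1 / norm w) *\<^sub>R w"
  have v: "norm v = 1" using w0 by (simp add: v_def)
  \<comment> \<open>The trace of the rank one matrix removed by the Cholesky step at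
    \<open>k\<close>; it is the weight of the vector state in the convex combination.\<close>
  define s where "s = (w \<bullet> w) / B $ k $ k"
  have s0: "0 < s" using w0 k by (simp add: s_def)
  define D where "D = B - s *\<^sub>R outer v v"
  have "s *\<^sub>R outer v v = (1 / B $ k $ k) *\<^sub>R outer w w"
    using w0 by (simp add: s_def v_def outer_def vec_eq_iff power2_norm_eq_inner[symmetric] power2_eq_square)
  then have D: "psd D" unfolding D_def using psd_subtract_column[OF B(1) k] by (simp add: w_def)
  have trD: "mat 1 \<bullet> D = 1 - s"
    using v by (simp add: D_def inner_diff_right B inner_mat_1_outer norm_eq_1)
  have s1: "s \<le> 1" using psd_inner_nonneg[OF psd_mat_1 D] trD by simp
  have "L = vec_state x v"
  proof (cases "s = 1")
    case True
    \<comment> \<open>The remainder \<open>D\<close> is positive semidefinite of trace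
      \<open>1 - s = 0\<close>, hence zero.\<close>
    then have "B = outer v v" using psd_trace_zero[OF D] trD by (simp add: D_def)
    then show ?thesis
      using eval by (intro state_eqI[OF Ls vec_state_state[OF G(1) x v]]) (simp add: vec_state_alt)
  next
    case False
    with s1 have s1: "s < 1" by simp
    \<comment> \<open>The remainder rescaled to trace 1. Purity then identifies the other summand,
      the vector state, with \<open>L\<close>.\<close>
    let ?L2 = "\<lambda>p\<in>Sym. mat_eval p x \<bullet> ((1 / (1 - s)) *\<^sub>R D)"
    have "?L2 \<in> states (quad_module G)"
      using s1 trD by (intro density_state[OF G(1) x] psd_scaleR D) auto
    moreover have "\<forall>p\<in>Sym. L p = s * vec_state x v p + (1 - s) * ?L2 p"
      using s1 by (auto simp: eval vec_state_alt D_def inner_diff_right)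
    ultimately show ?thesis
      using L s0 s1 vec_state_state[OF G(1) x v] unfolding pure_states_def by blast
  qed
  with x v show ?thesis by (rule that)
qed

text \<open>Domination carries zeros over: an element of the quadratic module annihilated by the
  vector state is annihilated by \<open>K\<close>. Squares vanishing at \<open>x\<close> recover the
  point, and rank one matrices orthogonal to \<open>v\<close> recover the density matrix.\<close>

lemma state_dominated_by_vec_state:
  assumes G: "G \<subseteq> Sym" "archimedean (quad_module G)" and K: "K \<in> states (quad_module G)"
    and v: "norm v = 1" and dom: "\<And>m. m \<in> quad_module G \<Longrightarrow> K m \<le> r * vec_state x v m"
    and p: "p \<in> Sym"
  shows "K p = vec_state x v p"
proof -
  have X: "K (mat (Var i) ** q) = x $ i * K q" if q: "q \<in> Sym" for i q
  proof -
    let ?f = "Var i - Const (x $ i)"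
    have qm: "mat (?f * ?f) \<in> quad_module G"
      using qm_square_mult[OF qm_generator[of "mat 1" G "mat 1"]] by simp
    have "mat_eval (mat (?f * ?f)) x = (0 :: real ^ 'b ^ 'b)" by simp
    then have "K (mat (?f * ?f)) \<le> 0" using dom[OF qm] by (simp add: vec_state_def)
    with state_nonneg[OF K qm] have "K (mat (?f * ?f)) = 0" by simp
    from state_square_vanish(2)[OF G K this q] show ?thesis
      by (simp add: state_poly_diff[OF K q] state_scale[OF K q])
  qed
  define B where "B = state_matrix K"
  have eval: "K p = mat_eval p x \<bullet> B" if "p \<in> Sym" for p
    unfolding B_def using K X that by (rule state_at_point)
  have B: "psd B" "mat 1 \<bullet> B = 1" unfolding B_def
    using psd_state_matrix[OF K X] trace_state_matrix[OF K X] by auto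
  have ker: "B *v u = 0" if "u \<bullet> v = 0" for u
  proof (rule psd_kernel[OF B(1)])
    have S: "cmat (outer u u) \<in> Sym" by (rule cmat_Sym[OF transpose_outer])
    have "K (cmat (outer u u)) \<le> 0"
      using dom[OF cmat_outer_qm, of u] that by (simp add: vec_state_def S outer_mult_vec)
    then have "(B *v u) \<bullet> u \<le> 0" by (simp add: eval S inner_commute[of _ B] inner_outer)
    moreover have "0 \<le> (B *v u) \<bullet> u" using B(1) by (simp add: psd_def)
    ultimately show "(B *v u) \<bullet> u = 0" by simp
  qed
  define b where "b = B *v v"
  have Bu: "B *v u = (u \<bullet> v) *\<^sub>R b" for u
  proof -
    \<comment> \<open>The component of \<open>u\<close> orthogonal to \<open>v\<close> lies in the
      kernel, so \<open>B\<close> is determined by its value at \<open>v\<close>.\<close>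
    have "B *v (u - (u \<bullet> v) *\<^sub>R v) = 0"
      using v by (intro ker) (simp add: inner_diff_left norm_eq_1)
    then show ?thesis
      by (simp add: b_def matrix_vector_mult_diff_distrib matrix_vector_mult_scaleR)
  qed
  define c where "c = b \<bullet> v"
  \<comment> \<open>Symmetry of \<open>B\<close> forces the image vector \<open>b\<close> to be a
    multiple of \<open>v\<close>.\<close>
  have "b \<bullet> u = (c *\<^sub>R v) \<bullet> u" for u
    using psd_symmetric[OF B(1), of v u] by (simp add: Bu[of u] c_def inner_commute flip: b_def)
  then have b: "b = c *\<^sub>R v" by (rule vector_eq_rdot[THEN iffD1, OF allI])
  have "B $ i $ j = (c *\<^sub>R outer v v) $ i $ j" for i j
    using matrix_vector_axis_inner[of B j i] unfolding Bu b
    by (simp add: outer_def inner_axis inner_axis' mult_ac)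
  then have B': "B = c *\<^sub>R outer v v" by (simp add: vec_eq_iff)
  have "c = 1" using B(2) v unfolding B' by (simp add: inner_mat_1_outer norm_eq_1)
  with B' have "B = outer v v" by simp
  then show ?thesis using p by (simp add: eval vec_state_alt)
qed

text \<open>In a convex combination with weight \<open>s\<close> on \<open>K\<close>, the other
  summand is nonnegative on the quadratic module. Hence \<open>K\<close> is dominated there by
  \<open>1 / s\<close> times the vector state.\<close>

lemma vec_state_pure:
  assumes G: "G \<subseteq> Sym" "archimedean (quad_module G)" and x: "x \<in> pos_set G" and v: "norm v = 1"
  shows "vec_state x v \<in> pure_states (quad_module G)"
proof -
  let ?L = "vec_state x v"
  have L: "?L \<in> states (quad_module G)" by (rule vec_state_state[OF G(1) x v])
  have key: "K = ?L" if K: "K \<in> states (quad_module G)" "K' \<in> states (quad_module G)"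
    and s: "0 < s" "s < 1" and conv: "\<forall>p\<in>Sym. ?L p = s * K p + (1 - s) * K' p" for K K' s
  proof (rule state_eqI[OF K(1) L])
    fix p :: "('a, 'b) matpoly" assume p: "p \<in> Sym"
    show "K p = ?L p"
    proof (rule state_dominated_by_vec_state[OF G K(1) v _ p])
      fix m assume m: "m \<in> quad_module G"
      then have "?L m = s * K m + (1 - s) * K' m" using conv qm_subset_Sym[OF G(1)] by blast
      moreover have "0 \<le> (1 - s) * K' m" using state_nonneg[OF K(2) m] s by simp
      ultimately show "K m \<le> (1 / s) * ?L m" using s by (simp add: field_simps)
    qed
  qed
  show ?thesis unfolding pure_states_def mem_Collect_eq
  proof (intro conjI ballI allI impI L)
    fix L1 L2 s
    assume S: "L1 \<in> states (quad_module G)" "L2 \<in> states (quad_module G)"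
      and c: "0 < s \<and> s < 1 \<and> (\<forall>p\<in>Sym. ?L p = s * L1 p + (1 - s) * L2 p)"
    show "L1 = ?L" using key[OF S] c by blast
    show "L2 = ?L" using key[OF S(2,1), of "1 - s"] c by (simp add: add.commute)
  qed
qed

section \<open>Lines and unit vectors\<close>

lemma line_scale: "c \<noteq> 0 \<Longrightarrow> line (c *\<^sub>R u) = line u"
  using span_image_scale[of "{u}" "\<lambda>_. c"] by simp

lemma line_unit_cases:
  assumes "norm v = 1" "norm w = 1"
  shows "line v = line w \<longleftrightarrow> v = w \<or> v = - w"
proof
  assume "line v = line w"
  then have "v \<in> span {w}" using span_base[of v "{v}"] by simp
  then obtain c where "v = c *\<^sub>R w" by (auto simp: span_singleton)
  with assms have "\<bar>c\<bar> = 1" "v = c *\<^sub>R w" by auto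
  then show "v = w \<or> v = - w" by (auto simp: abs_if split: if_splits)
next
  have m: "line (- w) = line w" using line_scale[of "- 1" w] by simp
  assume "v = w \<or> v = - w"
  then show "line v = line w" using m by (elim disjE) simp_all
qed

lemma vec_state_minus [simp]: "vec_state x (- v) = vec_state x v"
proof -
  have "outer (- v) (- v) = outer v v" by (simp add: outer_def)
  then show ?thesis by (simp add: vec_state_alt)
qed

lemma proj_space_unit:
  assumes "l \<in> proj_space"
  obtains v where "norm v = 1" "line v = l"
proof -
  obtain u where u: "l = line u" "u \<noteq> 0" using assms by (auto simp: proj_space_def)
  have "line ((1 / norm u) *\<^sub>R u) = line u"
    using u(2) by (intro line_scale) simp
  then show ?thesis using u by (intro that[of "(1 / norm u) *\<^sub>R u"]) simp_all
qed

text \<open>The unit vectors on a line differ only by a sign, which the quadratic form does not see.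
  This makes the description in \<open>line_state\<close> well-defined.\<close>

lemma vec_state_unique:
  assumes "norm v = 1" "norm w = 1" "line v = line w"
  shows "vec_state x v = vec_state x w"
proof -
  have "v = w \<or> v = - w" using line_unit_cases[OF assms(1,2)] assms(3) by blast
  then show ?thesis by (elim disjE) simp_all
qed

lemma line_state_line: "norm v = 1 \<Longrightarrow> line_state x (line v) = vec_state x v"
  unfolding line_state_def by (rule the_equality) (auto intro: vec_state_unique)

text \<open>The values at the variables recover the point. The value at the constant matrix
  \<open>outer v v\<close> gives \<open>(v \<bullet> w)^2 = 1\<close>, the equality case of
  Cauchy-Schwarz for unit vectors.\<close>

lemma vec_state_inject:
  fixes x y :: "real ^ 'n::finite" and v w :: "real ^ 't::finite"
  assumes v: "norm v = 1" and w: "norm w = 1"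
    and eq: "(vec_state x v :: ('n, 't) matpoly \<Rightarrow> real) = vec_state y w"
  shows "x = y" "line v = line w"
proof -
  have "(mat c *v u) \<bullet> u = c * (u \<bullet> u)" for c and u :: "real ^ 't"
    using inner_outer[of "mat c" u] inner_mat[of c "outer u u"] by (simp add: inner_mat_1_outer)
  then have "vec_state z u (mat (Var i)) = z $ i" if "norm u = 1" for z :: "real ^ 'n" and u :: "real ^ 't" and i
    using that by (simp add: vec_state_def norm_eq_1)
  from this[OF v, of x] this[OF w, of y] show "x = y" using eq by (simp add: vec_eq_iff)
  have S: "(cmat (outer v v) :: ('n, 't) matpoly) \<in> Sym"
    by (rule cmat_Sym[OF transpose_outer])
  have "vec_state z u (cmat (outer v v)) = (v \<bullet> u)\<^sup>2" for z :: "real ^ 'n" and u :: "real ^ 't"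
    by (simp add: vec_state_def S outer_mult_vec power2_eq_square)
  from this[of x v] this[of y w] have one: "(v \<bullet> w)\<^sup>2 = 1" using eq v by (simp add: norm_eq_1)
  define c where "c = v \<bullet> w"
  \<comment> \<open>The squared distance of \<open>v\<close> from its projection to the line of
    \<open>w\<close>; it vanishes because \<open>c\<close> has square 1.\<close>
  have "(v - c *\<^sub>R w) \<bullet> (v - c *\<^sub>R w) = 1 - c\<^sup>2"
    using v w by (simp add: inner_diff inner_commute norm_eq_1 power2_eq_square c_def)
  then have "v = c *\<^sub>R w" using one by (simp add: c_def)
  moreover have "c = 1 \<or> c = - 1" using one by (simp add: c_def power2_eq_1_iff)
  ultimately have "v = w \<or> v = - w" by auto
  then show "line v = line w" using line_unit_cases[OF v w] by blast
qed

section \<open>The bijection onto the pure states\<close>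

theorem corollary11:
  fixes G :: "('n::finite, 't::finite) matpoly set"
  assumes "G \<subseteq> Sym"
    and "archimedean (quad_module G)"
  shows "(\<forall>x\<in>pos_set G. \<forall>l\<in>(proj_space :: (real ^ 't) set set).
            \<exists>!L :: ('n, 't) matpoly \<Rightarrow> real. \<exists>v. norm v = 1 \<and> line v = l \<and> L = vec_state x v)
       \<and> bij_betw (\<lambda>(x, l). line_state x l) (pos_set G \<times> proj_space) (pure_states (quad_module G))"
proof (intro conjI ballI)
  fix x :: "real ^ 'n" and l :: "(real ^ 't) set" assume "l \<in> proj_space"
  then obtain v where "norm v = 1" "line v = l" by (rule proj_space_unit)
  then show "\<exists>!L :: ('n, 't) matpoly \<Rightarrow> real. \<exists>v. norm v = 1 \<and> line v = l \<and> L = vec_state x v"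
    by (intro ex1I[of _ "vec_state x v"]) (auto intro: vec_state_unique)
next
  let ?F = "\<lambda>(x, l). line_state x l :: ('n, 't) matpoly \<Rightarrow> real"
  show "bij_betw ?F (pos_set G \<times> proj_space) (pure_states (quad_module G))"
    unfolding bij_betw_def
  proof
    show "inj_on ?F (pos_set G \<times> proj_space)"
    proof (rule inj_onI, clarsimp)
      fix x y :: "real ^ 'n" and l m :: "(real ^ 't) set"
      assume lm: "l \<in> proj_space" "m \<in> proj_space"
        and eq: "line_state x l = (line_state y m :: ('n, 't) matpoly \<Rightarrow> real)"
      obtain v w where v: "norm v = 1" "line v = l" and w: "norm w = 1" "line w = m"
        using proj_space_unit lm by metis
      then have "vec_state x v = (vec_state y w :: ('n, 't) matpoly \<Rightarrow> real)"
        using eq line_state_line by metis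
      with v w show "x = y \<and> l = m" using vec_state_inject by blast
    qed
    show "?F ` (pos_set G \<times> proj_space) = pure_states (quad_module G)"
    proof (intro equalityI subsetI)
      fix L assume "L \<in> ?F ` (pos_set G \<times> proj_space)"
      then obtain x l where x: "x \<in> pos_set G" and l: "l \<in> proj_space" and L: "L = line_state x l"
        by auto
      obtain v where "norm v = 1" "line v = l" using l by (rule proj_space_unit)
      then show "L \<in> pure_states (quad_module G)"
        using vec_state_pure[OF assms x] line_state_line[of v x] L by simp
    next
      fix L assume "L \<in> pure_states (quad_module G)"
      then obtain x v where xv: "x \<in> pos_set G" "norm v = 1" "L = vec_state x v"
        by (rule pure_state_is_vec_state[OF assms])
      then have "line v \<in> proj_space" unfolding proj_space_def by (intro CollectI exI[of _ v]) auto
      with xv show "L \<in> ?F ` (pos_set G \<times> proj_space)"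
        by (intro image_eqI[of _ _ "(x, line v)"]) (simp_all add: line_state_line)
    qed
  qed
qed

end
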